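(* Let $\mathcal{M}$ be a biclosed monoidal category and let $(M,\tau)$ be an object of $\mathcal{Z}'_{\mathcal{M}}(\mathcal{M}^{op})$, i.e. an object of the weak center of the contragradient bimodule category $\mathcal{M}^{op}$ that satisfies the stability condition. Then $(M,\tau)$ is an object of the (strong) center $\mathcal{Z}_{\mathcal{M}}(\mathcal{M}^{op})$; that is, $\tau_{V}: V\triangleright M\to M\triangleleft V$ is an isomorphism for every $V\in\mathcal{M}$.
   Context: Let $\mathcal{M}$ be a monoidal category with unit $1$. It is biclosed if there are left and right internal homs with natural adjunctions $\mathrm{Hom}_{\mathcal{M}}(W\otimes V,M)\simeq \mathrm{Hom}_{\mathcal{M}}(W,\mathrm{Hom}^l(V,M))$ and $\mathrm{Hom}_{\mathcal{M}}(V\otimes W,M)\simeq \mathrm{Hom}_{\mathcal{M}}(W,\mathrm{Hom}^r(V,M))$. The contragradient $\mathcal{M}$-bimodule category $\mathcal{M}^{op}$ has the objects of $\mathcal{M}$, with actions $V\triangleright M:=\mathrm{Hom}^l(V,M)$ and $M\triangleleft V:=\mathrm{Hom}^r(V,M)$. Its associativity isomorphisms $V\triangleright(W\triangleright M)\simeq (V\otimes W)\triangleright M$, $V\triangleright(M\triangleleft W)\simeq (V\triangleright M)\triangleleft W$, $M\triangleleft(V\otimes W)\simeq (M\triangleleft V)\triangleleft W$ are those induced, via the Yoneda lemma and the adjunctions, by the associativity constraint of $\mathcal{M}$; similarly $1\triangleright M\simeq M\simeq M\triangleleft 1$ come from the unit constraints. Weak center of $\mathcal{M}^{op}$: objects are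 pairs $(M,\tau)$ with $M\in\mathcal{M}$ and $\tau=(\tau_V)_{V\in\mathcal{M}}$ a family of morphisms of $\mathcal{M}$, $\tau_V:V\triangleright M\to M\triangleleft V$, natural in $V$, satisfying the hexagon axiom: the composite $V\triangleright(W\triangleright M)\xrightarrow{id\triangleright\tau_W}V\triangleright(M\triangleleft W)\simeq(V\triangleright M)\triangleleft W\xrightarrow{\tau_V\triangleleft id}(M\triangleleft V)\triangleleft W$ equals the composite $V\triangleright(W\triangleright M)\simeq(V\otimes W)\triangleright M\xrightarrow{\tau_{V\otimes W}}M\triangleleft(V\otimes W)\simeq(M\triangleleft V)\triangleleft W$, and such that $\tau_1$ is the identity of $M$ under $1\triangleright M\simeq M\simeq M\triangleleft 1$. The (strong) center $\mathcal{Z}_{\mathcal{M}}(\mathcal{M}^{op})$ consists of those $(M,\tau)$ for which all $\tau_V$ are isomorphisms. $\mathcal{Z}'_{\mathcal{M}}(\mathcal{M}^{op})$ is the full subcategory of the weak center consisting of the $(M,\tau)$ satisfying stability: the identity $Id\in \mathrm{Hom}_{\mathcal{M}}(M,M)$ is mapped to itself by $$\mathrm{Hom}_{\mathcal{M}}(M,M)\simeq \mathrm{Hom}_{\mathcal{M}}(1,M\triangleright M)\xrightarrow{\tau_M\circ-}\mathrm{Hom}_{\mathcal{M}}(1,M\triangleleft M)\simeq \mathrm{Hom}_{\mathcal{M}}(M,M),$$ where the isomorphisms come from the unit constraints and the adjunctions. *)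

theory Defs
  imports Main
begin

section \<open>Categories\<close>

record ('o, 'a) category_data =
  Obj :: "'o set"
  Arr :: "'a set"
  Dom :: "'a \<Rightarrow> 'o"
  Cod :: "'a \<Rightarrow> 'o"
  Ident :: "'o \<Rightarrow> 'a"
  Comp :: "'a \<Rightarrow> 'a \<Rightarrow> 'a"  (infixl \<open>\<cdot>\<index>\<close> 65)

definition Hom :: "('o, 'a, 'm) category_data_scheme \<Rightarrow> 'o \<Rightarrow> 'o \<Rightarrow> 'a set" where
  "Hom C A B = {f \<in> Arr C. Dom C f = A \<and> Cod C f = B}"

locale category =
  fixes C :: "('o, 'a, 'm) category_data_scheme" (structure)
  assumes Dom_Obj: "f \<in> Arr C \<Longrightarrow> Dom C f \<in> Obj C"
    and Cod_Obj: "f \<in> Arr C \<Longrightarrow> Cod C f \<in> Obj C"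
    and Ident_Hom: "A \<in> Obj C \<Longrightarrow> Ident C A \<in> Hom C A A"
    and Comp_Hom: "f \<in> Hom C A B \<Longrightarrow> g \<in> Hom C B D \<Longrightarrow> g \<cdot> f \<in> Hom C A D"
    and Comp_Ident: "f \<in> Hom C A B \<Longrightarrow> f \<cdot> Ident C A = f"
    and Ident_Comp: "f \<in> Hom C A B \<Longrightarrow> Ident C B \<cdot> f = f"
    and Comp_assoc: "f \<in> Hom C A B \<Longrightarrow> g \<in> Hom C B D \<Longrightarrow> h \<in> Hom C D E \<Longrightarrow>
                       (h \<cdot> g) \<cdot> f = h \<cdot> (g \<cdot> f)"

definition inverse_arrows :: "('o, 'a, 'm) category_data_scheme \<Rightarrow> 'a \<Rightarrow> 'a \<Rightarrow> bool"
  where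
  "inverse_arrows C f g \<longleftrightarrow>
     f \<in> Arr C \<and> g \<in> Hom C (Cod C f) (Dom C f) \<and>
     g \<cdot> f = Ident C (Dom C f) \<and> f \<cdot> g = Ident C (Cod C f)"
  for C (structure)

definition iso :: "('o, 'a, 'm) category_data_scheme \<Rightarrow> 'a \<Rightarrow> bool" where
  "iso C f \<longleftrightarrow> (\<exists>g. inverse_arrows C f g)"

definition inverse_arr :: "('o, 'a, 'm) category_data_scheme \<Rightarrow> 'a \<Rightarrow> 'a" where
  "inverse_arr C f = (THE g. inverse_arrows C f g)"

text \<open>
  The arrow \<open>A \<rightarrow> B\<close> which, by the Yoneda lemma, represents a natural family of maps
  \<open>\<Phi> X\<close> from \<open>Hom(X, A)\<close> to \<open>Hom(X, B)\<close>.
\<close>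

definition yoneda :: "('o, 'a, 'm) category_data_scheme \<Rightarrow> 'o \<Rightarrow> ('o \<Rightarrow> 'a \<Rightarrow> 'a) \<Rightarrow> 'a" where
  "yoneda C A \<Phi> = \<Phi> A (Ident C A)"


section \<open>Monoidal categories\<close>

record ('o, 'a) monoidal_data = "('o, 'a) category_data" +
  tensor :: "'o \<Rightarrow> 'o \<Rightarrow> 'o"  (infixl \<open>\<otimes>\<index>\<close> 70)
  tensor_arr :: "'a \<Rightarrow> 'a \<Rightarrow> 'a"  (infixl \<open>\<odot>\<index>\<close> 70)
  unit_obj :: "'o"  (\<open>\<one>\<index>\<close>)
  assoc :: "'o \<Rightarrow> 'o \<Rightarrow> 'o \<Rightarrow> 'a"  (\<open>\<a>\<index>\<close>)
  lunit :: "'o \<Rightarrow> 'a"  (\<open>\<l>\<index>\<close>)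
  runit :: "'o \<Rightarrow> 'a"  (\<open>\<r>\<index>\<close>)

locale monoidal_category = category C
  for C :: "('o, 'a, 'm) monoidal_data_scheme" (structure) +
  assumes tensor_Obj: "A \<in> Obj C \<Longrightarrow> B \<in> Obj C \<Longrightarrow> A \<otimes> B \<in> Obj C"
    and tensor_Hom: "f \<in> Hom C A A' \<Longrightarrow> g \<in> Hom C B B' \<Longrightarrow>
                       f \<odot> g \<in> Hom C (A \<otimes> B) (A' \<otimes> B')"
    and tensor_Ident: "A \<in> Obj C \<Longrightarrow> B \<in> Obj C \<Longrightarrow>
                       Ident C A \<odot> Ident C B = Ident C (A \<otimes> B)"
    and tensor_Comp: "f \<in> Hom C A A' \<Longrightarrow> f' \<in> Hom C A' A'' \<Longrightarrow>
                      g \<in> Hom C B B' \<Longrightarrow> g' \<in> Hom C B' B'' \<Longrightarrow>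
                       (f' \<cdot> f) \<odot> (g' \<cdot> g) = (f' \<odot> g') \<cdot> (f \<odot> g)"
    and unit_Obj: "\<one> \<in> Obj C"
    and assoc_Hom: "A \<in> Obj C \<Longrightarrow> B \<in> Obj C \<Longrightarrow> D \<in> Obj C \<Longrightarrow>
                       \<a> A B D \<in> Hom C (A \<otimes> B \<otimes> D) (A \<otimes> (B \<otimes> D))"
    and assoc_iso: "A \<in> Obj C \<Longrightarrow> B \<in> Obj C \<Longrightarrow> D \<in> Obj C \<Longrightarrow> iso C (\<a> A B D)"
    and assoc_natural: "f \<in> Hom C A A' \<Longrightarrow> g \<in> Hom C B B' \<Longrightarrow> h \<in> Hom C D D' \<Longrightarrow>
                       \<a> A' B' D' \<cdot> ((f \<odot> g) \<odot> h) = (f \<odot> (g \<odot> h)) \<cdot> \<a> A B D"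
    and lunit_Hom: "A \<in> Obj C \<Longrightarrow> \<l> A \<in> Hom C (\<one> \<otimes> A) A"
    and lunit_iso: "A \<in> Obj C \<Longrightarrow> iso C (\<l> A)"
    and lunit_natural: "f \<in> Hom C A A' \<Longrightarrow> \<l> A' \<cdot> (Ident C \<one> \<odot> f) = f \<cdot> \<l> A"
    and runit_Hom: "A \<in> Obj C \<Longrightarrow> \<r> A \<in> Hom C (A \<otimes> \<one>) A"
    and runit_iso: "A \<in> Obj C \<Longrightarrow> iso C (\<r> A)"
    and runit_natural: "f \<in> Hom C A A' \<Longrightarrow> \<r> A' \<cdot> (f \<odot> Ident C \<one>) = f \<cdot> \<r> A"
    and pentagon: "A \<in> Obj C \<Longrightarrow> B \<in> Obj C \<Longrightarrow> D \<in> Obj C \<Longrightarrow> E \<in> Obj C \<Longrightarrow>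
                       (Ident C A \<odot> \<a> B D E) \<cdot> \<a> A (B \<otimes> D) E \<cdot> (\<a> A B D \<odot> Ident C E)
                         = \<a> A B (D \<otimes> E) \<cdot> \<a> (A \<otimes> B) D E"
    and triangle: "A \<in> Obj C \<Longrightarrow> B \<in> Obj C \<Longrightarrow>
                       (Ident C A \<odot> \<l> B) \<cdot> \<a> A \<one> B = \<r> A \<odot> Ident C B"


section \<open>Biclosed monoidal categories\<close>

text \<open>
  \<open>lhom V M\<close> and \<open>rhom V M\<close> are the internal homs \<open>Hom\<^sup>l(V, M)\<close> and \<open>Hom\<^sup>r(V, M)\<close>;
  \<open>lhom_arr\<close> and \<open>rhom_arr\<close> are their actions on arrows, contravariant in the first
  argument. The adjunction bijections
    \<open>lcurry W V M\<close>: \<open>Hom(W \<otimes> V, M) \<rightarrow> Hom(W, Hom\<^sup>l(V, M))\<close> and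
    \<open>rcurry V W M\<close>: \<open>Hom(V \<otimes> W, M) \<rightarrow> Hom(W, Hom\<^sup>r(V, M))\<close>
  carry their objects explicitly, since \<open>W\<close> and \<open>V\<close> cannot be recovered from the
  object \<open>W \<otimes> V\<close>.
\<close>

record ('o, 'a) biclosed_data = "('o, 'a) monoidal_data" +
  lhom :: "'o \<Rightarrow> 'o \<Rightarrow> 'o"
  lhom_arr :: "'a \<Rightarrow> 'a \<Rightarrow> 'a"
  lcurry :: "'o \<Rightarrow> 'o \<Rightarrow> 'o \<Rightarrow> 'a \<Rightarrow> 'a"
  rhom :: "'o \<Rightarrow> 'o \<Rightarrow> 'o"
  rhom_arr :: "'a \<Rightarrow> 'a \<Rightarrow> 'a"
  rcurry :: "'o \<Rightarrow> 'o \<Rightarrow> 'o \<Rightarrow> 'a \<Rightarrow> 'a"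

locale biclosed_monoidal_category = monoidal_category C
  for C :: "('o, 'a, 'm) biclosed_data_scheme" (structure) +
  assumes lhom_Obj: "V \<in> Obj C \<Longrightarrow> M \<in> Obj C \<Longrightarrow> lhom C V M \<in> Obj C"
    and lhom_Hom: "v \<in> Hom C V' V \<Longrightarrow> m \<in> Hom C M M' \<Longrightarrow>
                     lhom_arr C v m \<in> Hom C (lhom C V M) (lhom C V' M')"
    and lhom_Ident: "V \<in> Obj C \<Longrightarrow> M \<in> Obj C \<Longrightarrow>
                     lhom_arr C (Ident C V) (Ident C M) = Ident C (lhom C V M)"
    and lhom_Comp: "v \<in> Hom C V' V \<Longrightarrow> v' \<in> Hom C V'' V' \<Longrightarrow>
                    m \<in> Hom C M M' \<Longrightarrow> m' \<in> Hom C M' M'' \<Longrightarrow>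
                     lhom_arr C (v \<cdot> v') (m' \<cdot> m) = lhom_arr C v' m' \<cdot> lhom_arr C v m"
    and lcurry_bij: "W \<in> Obj C \<Longrightarrow> V \<in> Obj C \<Longrightarrow> M \<in> Obj C \<Longrightarrow>
                     bij_betw (lcurry C W V M) (Hom C (W \<otimes> V) M) (Hom C W (lhom C V M))"
    and lcurry_natural: "w \<in> Hom C W' W \<Longrightarrow> v \<in> Hom C V' V \<Longrightarrow> m \<in> Hom C M M' \<Longrightarrow>
                    f \<in> Hom C (W \<otimes> V) M \<Longrightarrow>
                     lcurry C W' V' M' (m \<cdot> f \<cdot> (w \<odot> v)) = lhom_arr C v m \<cdot> lcurry C W V M f \<cdot> w"
    and rhom_Obj: "V \<in> Obj C \<Longrightarrow> M \<in> Obj C \<Longrightarrow> rhom C V M \<in> Obj C"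
    and rhom_Hom: "v \<in> Hom C V' V \<Longrightarrow> m \<in> Hom C M M' \<Longrightarrow>
                     rhom_arr C v m \<in> Hom C (rhom C V M) (rhom C V' M')"
    and rhom_Ident: "V \<in> Obj C \<Longrightarrow> M \<in> Obj C \<Longrightarrow>
                     rhom_arr C (Ident C V) (Ident C M) = Ident C (rhom C V M)"
    and rhom_Comp: "v \<in> Hom C V' V \<Longrightarrow> v' \<in> Hom C V'' V' \<Longrightarrow>
                    m \<in> Hom C M M' \<Longrightarrow> m' \<in> Hom C M' M'' \<Longrightarrow>
                     rhom_arr C (v \<cdot> v') (m' \<cdot> m) = rhom_arr C v' m' \<cdot> rhom_arr C v m"
    and rcurry_bij: "V \<in> Obj C \<Longrightarrow> W \<in> Obj C \<Longrightarrow> M \<in> Obj C \<Longrightarrow>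
                     bij_betw (rcurry C V W M) (Hom C (V \<otimes> W) M) (Hom C W (rhom C V M))"
    and rcurry_natural: "v \<in> Hom C V' V \<Longrightarrow> w \<in> Hom C W' W \<Longrightarrow> m \<in> Hom C M M' \<Longrightarrow>
                    f \<in> Hom C (V \<otimes> W) M \<Longrightarrow>
                     rcurry C V' W' M' (m \<cdot> f \<cdot> (v \<odot> w)) = rhom_arr C v m \<cdot> rcurry C V W M f \<cdot> w"

definition luncurry :: "('o, 'a, 'm) biclosed_data_scheme \<Rightarrow> 'o \<Rightarrow> 'o \<Rightarrow> 'o \<Rightarrow> 'a \<Rightarrow> 'a"
  where
  "luncurry C W V M = inv_into (Hom C (W \<otimes> V) M) (lcurry C W V M)"
  for C (structure)

definition runcurry :: "('o, 'a, 'm) biclosed_data_scheme \<Rightarrow> 'o \<Rightarrow> 'o \<Rightarrow> 'o \<Rightarrow> 'a \<Rightarrow> 'a"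
  where
  "runcurry C V W M = inv_into (Hom C (V \<otimes> W) M) (rcurry C V W M)"
  for C (structure)


section \<open>The contragradient bimodule category\<close>

definition lact :: "('o, 'a, 'm) biclosed_data_scheme \<Rightarrow> 'o \<Rightarrow> 'o \<Rightarrow> 'o"
    (infix \<open>\<triangleright>\<index>\<close> 75) where
  "V \<triangleright>\<^bsub>C\<^esub> M = lhom C V M"

definition ract :: "('o, 'a, 'm) biclosed_data_scheme \<Rightarrow> 'o \<Rightarrow> 'o \<Rightarrow> 'o"
    (infix \<open>\<triangleleft>\<index>\<close> 75) where
  "M \<triangleleft>\<^bsub>C\<^esub> V = rhom C V M"

definition lact_arr :: "('o, 'a, 'm) biclosed_data_scheme \<Rightarrow> 'o \<Rightarrow> 'a \<Rightarrow> 'a" where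
  "lact_arr C V f = lhom_arr C (Ident C V) f"

definition ract_arr :: "('o, 'a, 'm) biclosed_data_scheme \<Rightarrow> 'a \<Rightarrow> 'o \<Rightarrow> 'a" where
  "ract_arr C f V = rhom_arr C (Ident C V) f"

text \<open>\<open>V \<triangleright> (W \<triangleright> M) \<rightarrow> (V \<otimes> W) \<triangleright> M\<close>, from
  \<open>Hom(X, V \<triangleright> (W \<triangleright> M)) \<simeq> Hom(X \<otimes> V, W \<triangleright> M) \<simeq> Hom((X \<otimes> V) \<otimes> W, M)
   \<simeq> Hom(X \<otimes> (V \<otimes> W), M) \<simeq> Hom(X, (V \<otimes> W) \<triangleright> M)\<close>.\<close>

definition lact_assoc :: "('o, 'a, 'm) biclosed_data_scheme \<Rightarrow> 'o \<Rightarrow> 'o \<Rightarrow> 'o \<Rightarrow> 'a"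
  where
  "lact_assoc C V W M = yoneda C (V \<triangleright> (W \<triangleright> M)) (\<lambda>X f.
     lcurry C X (V \<otimes> W) M
       (luncurry C (X \<otimes> V) W M (luncurry C X V (W \<triangleright> M) f) \<cdot> inverse_arr C (\<a> X V W)))"
  for C (structure)

text \<open>\<open>V \<triangleright> (M \<triangleleft> W) \<rightarrow> (V \<triangleright> M) \<triangleleft> W\<close>, from
  \<open>Hom(X, V \<triangleright> (M \<triangleleft> W)) \<simeq> Hom(X \<otimes> V, M \<triangleleft> W) \<simeq> Hom(W \<otimes> (X \<otimes> V), M)
   \<simeq> Hom((W \<otimes> X) \<otimes> V, M) \<simeq> Hom(W \<otimes> X, V \<triangleright> M) \<simeq> Hom(X, (V \<triangleright> M) \<triangleleft> W)\<close>.\<close>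

definition mid_assoc :: "('o, 'a, 'm) biclosed_data_scheme \<Rightarrow> 'o \<Rightarrow> 'o \<Rightarrow> 'o \<Rightarrow> 'a"
  where
  "mid_assoc C V M W = yoneda C (V \<triangleright> (M \<triangleleft> W)) (\<lambda>X f.
     rcurry C W X (V \<triangleright> M) (lcurry C (W \<otimes> X) V M
       (runcurry C W (X \<otimes> V) M (luncurry C X V (M \<triangleleft> W) f) \<cdot> \<a> W X V)))"
  for C (structure)

text \<open>\<open>M \<triangleleft> (V \<otimes> W) \<rightarrow> (M \<triangleleft> V) \<triangleleft> W\<close>, from
  \<open>Hom(X, M \<triangleleft> (V \<otimes> W)) \<simeq> Hom((V \<otimes> W) \<otimes> X, M) \<simeq> Hom(V \<otimes> (W \<otimes> X), M)
   \<simeq> Hom(W \<otimes> X, M \<triangleleft> V) \<simeq> Hom(X, (M \<triangleleft> V) \<triangleleft> W)\<close>.\<close>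

definition ract_assoc :: "('o, 'a, 'm) biclosed_data_scheme \<Rightarrow> 'o \<Rightarrow> 'o \<Rightarrow> 'o \<Rightarrow> 'a"
  where
  "ract_assoc C M V W = yoneda C (M \<triangleleft> (V \<otimes> W)) (\<lambda>X f.
     rcurry C W X (M \<triangleleft> V) (rcurry C V (W \<otimes> X) M
       (runcurry C (V \<otimes> W) X M f \<cdot> inverse_arr C (\<a> V W X))))"
  for C (structure)

text \<open>\<open>\<one> \<triangleright> M \<rightarrow> M\<close> and \<open>M \<triangleleft> \<one> \<rightarrow> M\<close>, from
  \<open>Hom(X, \<one> \<triangleright> M) \<simeq> Hom(X \<otimes> \<one>, M) \<simeq> Hom(X, M)\<close> and
  \<open>Hom(X, M \<triangleleft> \<one>) \<simeq> Hom(\<one> \<otimes> X, M) \<simeq> Hom(X, M)\<close>.\<close>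

definition lact_unit :: "('o, 'a, 'm) biclosed_data_scheme \<Rightarrow> 'o \<Rightarrow> 'a"
  where
  "lact_unit C M = yoneda C (\<one> \<triangleright> M) (\<lambda>X f. luncurry C X \<one> M f \<cdot> inverse_arr C (\<r> X))"
  for C (structure)

definition ract_unit :: "('o, 'a, 'm) biclosed_data_scheme \<Rightarrow> 'o \<Rightarrow> 'a"
  where
  "ract_unit C M = yoneda C (M \<triangleleft> \<one>) (\<lambda>X f. runcurry C \<one> X M f \<cdot> inverse_arr C (\<l> X))"
  for C (structure)


section \<open>Weak center, center, and stability\<close>

text \<open>
  Only the objects of these categories are described. A family \<open>\<tau>\<close> is a function on the
  type of objects, of which only the values on \<open>Obj C\<close> are constrained.
\<close>

definition weak_center :: "('o, 'a, 'm) biclosed_data_scheme \<Rightarrow> ('o \<times> ('o \<Rightarrow> 'a)) set"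
  where
  "weak_center C = {(M, \<tau>).
     M \<in> Obj C \<and>
     (\<forall>V\<in>Obj C. \<tau> V \<in> Hom C (V \<triangleright> M) (M \<triangleleft> V)) \<and>
     (\<forall>V\<in>Obj C. \<forall>V'\<in>Obj C. \<forall>f\<in>Hom C V V'.
        \<tau> V \<cdot> lhom_arr C f (Ident C M) = rhom_arr C f (Ident C M) \<cdot> \<tau> V') \<and>
     (\<forall>V\<in>Obj C. \<forall>W\<in>Obj C.
        ract_arr C (\<tau> V) W \<cdot> mid_assoc C V M W \<cdot> lact_arr C V (\<tau> W) =
        ract_assoc C M V W \<cdot> \<tau> (V \<otimes> W) \<cdot> lact_assoc C V W M) \<and>
     ract_unit C M \<cdot> \<tau> \<one> = lact_unit C M}"
  for C (structure)

definition center :: "('o, 'a, 'm) biclosed_data_scheme \<Rightarrow> ('o \<times> ('o \<Rightarrow> 'a)) set" where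
  "center C = {(M, \<tau>). (M, \<tau>) \<in> weak_center C \<and> (\<forall>V\<in>Obj C. iso C (\<tau> V))}"

text \<open>
  The map \<open>Hom(M, M) \<simeq> Hom(\<one> \<otimes> M, M) \<simeq> Hom(\<one>, M \<triangleright> M) \<rightarrow> Hom(\<one>, M \<triangleleft> M) \<simeq> Hom(M \<otimes> \<one>, M)
  \<simeq> Hom(M, M)\<close>, whose middle arrow is composition with \<open>\<tau> M\<close>.
\<close>

definition stability_map ::
    "('o, 'a, 'm) biclosed_data_scheme \<Rightarrow> 'o \<Rightarrow> ('o \<Rightarrow> 'a) \<Rightarrow> 'a \<Rightarrow> 'a"
  where
  "stability_map C M \<tau> f =
     runcurry C M \<one> M (\<tau> M \<cdot> lcurry C \<one> M M (f \<cdot> \<l> M)) \<cdot> inverse_arr C (\<r> M)"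
  for C (structure)

definition stable_weak_center ::
    "('o, 'a, 'm) biclosed_data_scheme \<Rightarrow> ('o \<times> ('o \<Rightarrow> 'a)) set" where
  "stable_weak_center C =
     {(M, \<tau>). (M, \<tau>) \<in> weak_center C \<and> stability_map C M \<tau> (Ident C M) = Ident C M}"

end

theory Submission
  imports Defs
begin

text \<open>
  By the adjunctions, composition with \<open>\<tau> V\<close> is a family of maps
  \<open>rot X V\<close> from \<open>Hom(X \<otimes> V, M)\<close> to \<open>Hom(V \<otimes> X, M)\<close>, natural in \<open>X\<close> and \<open>V\<close>
  (\<open>rot_natural\<close>). Suppressing associators and units, the hexagon axiom says
  \<open>rot X (V \<otimes> W) = rot (W \<otimes> X) V \<circ> rot (X \<otimes> V) W\<close> (\<open>rot_hexagon\<close>),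
  while stability says that \<open>rot \<one> M\<close> fixes the identity of \<open>M\<close>. By naturality
  \<open>rot \<one> V\<close> is then the identity for every \<open>V\<close> (\<open>rot_unit\<close>), and the hexagon at \<open>X = \<one>\<close>
  becomes \<open>rot W V \<circ> rot V W = id\<close>. Hence every \<open>rot V W\<close> is bijective, and \<open>\<tau> V\<close> is
  invertible by the Yoneda lemma.

  With the coherence isomorphisms restored, \<open>rot W V \<circ> rot V W\<close> is precomposition with an
  automorphism of \<open>V \<otimes> W\<close> composed of associators and unitors (\<open>rot_rot\<close>). It is
  the identity by Kelly's coherence lemmas, but bijectivity of \<open>rot\<close> only needs that it is
  invertible, so these lemmas are not used.
\<close>

section \<open>Isomorphisms in a category\<close>

context category
begin

lemma Hom_Obj:
  assumes "f \<in> Hom C A B"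
  shows "A \<in> Obj C" "B \<in> Obj C"
  using assms Dom_Obj Cod_Obj by (auto simp: Hom_def)

lemma inverse_arrows_unique:
  assumes "inverse_arrows C f g" "inverse_arrows C f h"
  shows "g = h"
proof -
  let ?A = "Dom C f" and ?B = "Cod C f"
  have f: "f \<in> Hom C ?A ?B" and g: "g \<in> Hom C ?B ?A" and h: "h \<in> Hom C ?B ?A"
    and gf: "g \<cdot> f = Ident C ?A" and fh: "f \<cdot> h = Ident C ?B"
    using assms by (auto simp: inverse_arrows_def Hom_def)
  have "g = g \<cdot> (f \<cdot> h)"
    using Comp_Ident[OF g] fh by simp
  also have "\<dots> = h"
    using Comp_assoc[OF h f g] Ident_Comp[OF h] gf by simp
  finally show ?thesis .
qed

lemma inverse_arr:
  assumes "iso C f" "f \<in> Hom C A B"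
  shows inverse_arr_Hom: "inverse_arr C f \<in> Hom C B A"
    and inverse_arr_Comp: "inverse_arr C f \<cdot> f = Ident C A"
    and Comp_inverse_arr: "f \<cdot> inverse_arr C f = Ident C B"
proof -
  obtain g where "inverse_arrows C f g"
    using assms(1) by (auto simp: iso_def)
  then have "inverse_arrows C f (inverse_arr C f)"
    unfolding inverse_arr_def using inverse_arrows_unique by (metis theI)
  with assms(2) show "inverse_arr C f \<in> Hom C B A"
    "inverse_arr C f \<cdot> f = Ident C A" "f \<cdot> inverse_arr C f = Ident C B"
    by (auto simp: inverse_arrows_def Hom_def)
qed

lemma isoI:
  assumes "f \<in> Hom C A B" "g \<in> Hom C B A" "g \<cdot> f = Ident C A" "f \<cdot> g = Ident C B"
  shows "iso C f"
proof -
  have "inverse_arrows C f g"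
    using assms by (simp add: inverse_arrows_def Hom_def)
  then show ?thesis
    unfolding iso_def ..
qed

lemma iso_inverse_arr:
  assumes "iso C f" "f \<in> Hom C A B"
  shows "iso C (inverse_arr C f)"
  using isoI[OF inverse_arr_Hom[OF assms] assms(2) Comp_inverse_arr[OF assms]
      inverse_arr_Comp[OF assms]] .

lemma Comp_inverse_cancel:
  assumes "iso C f" "f \<in> Hom C A B" "g \<in> Hom C B D"
  shows "(g \<cdot> f) \<cdot> inverse_arr C f = g"
  using Comp_assoc[OF inverse_arr_Hom[OF assms(1,2)] assms(2,3)]
    Comp_inverse_arr[OF assms(1,2)] Comp_Ident[OF assms(3)] by simp

lemma inverse_Comp_cancel:
  assumes "iso C f" "f \<in> Hom C A B" "g \<in> Hom C A D"
  shows "(g \<cdot> inverse_arr C f) \<cdot> f = g"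
  using Comp_assoc[OF assms(2) inverse_arr_Hom[OF assms(1,2)] assms(3)]
    inverse_arr_Comp[OF assms(1,2)] Comp_Ident[OF assms(3)] by simp

lemma Ident_iso:
  assumes "A \<in> Obj C"
  shows "iso C (Ident C A)"
  using isoI[OF Ident_Hom[OF assms] Ident_Hom[OF assms]]
    Ident_Comp[OF Ident_Hom[OF assms]] by simp

lemma Comp_iso:
  assumes f: "iso C f" "f \<in> Hom C A B" and g: "iso C g" "g \<in> Hom C B D"
  shows "iso C (g \<cdot> f)"
proof (rule isoI)
  note if' = inverse_arr_Hom[OF f] and ig = inverse_arr_Hom[OF g]
  note i = Comp_Hom[OF ig if']
  show "g \<cdot> f \<in> Hom C A D"
    using Comp_Hom[OF f(2) g(2)] .
  show "inverse_arr C f \<cdot> inverse_arr C g \<in> Hom C D A"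
    using i .
  show "(inverse_arr C f \<cdot> inverse_arr C g) \<cdot> (g \<cdot> f) = Ident C A"
    using Comp_assoc[OF f(2) g(2) i] inverse_Comp_cancel[OF g if'] inverse_arr_Comp[OF f]
    by simp
  show "(g \<cdot> f) \<cdot> (inverse_arr C f \<cdot> inverse_arr C g) = Ident C D"
    using Comp_assoc[OF ig if' Comp_Hom[OF f(2) g(2)]] Comp_inverse_cancel[OF f g(2)]
      Comp_inverse_arr[OF g] by simp
qed

lemma iso_precomp_bij:
  assumes "iso C f" "f \<in> Hom C A B"
  shows "bij_betw (\<lambda>g. g \<cdot> f) (Hom C B D) (Hom C A D)"
proof (rule bij_betw_byWitness[where f' = "\<lambda>h. h \<cdot> inverse_arr C f"])
  show "\<forall>g\<in>Hom C B D. (g \<cdot> f) \<cdot> inverse_arr C f = g"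
    using Comp_inverse_cancel[OF assms] by blast
  show "\<forall>h\<in>Hom C A D. (h \<cdot> inverse_arr C f) \<cdot> f = h"
    using inverse_Comp_cancel[OF assms] by blast
  show "(\<lambda>g. g \<cdot> f) ` Hom C B D \<subseteq> Hom C A D"
    using Comp_Hom[OF assms(2)] by blast
  show "(\<lambda>h. h \<cdot> inverse_arr C f) ` Hom C A D \<subseteq> Hom C B D"
    using Comp_Hom[OF inverse_arr_Hom[OF assms]] by blast
qed

text \<open>An arrow is invertible if it induces bijections on all Hom sets into it.\<close>

lemma iso_if_postcomp_bij:
  assumes f: "f \<in> Hom C A B"
    and bij: "\<And>X. X \<in> Obj C \<Longrightarrow> bij_betw (\<lambda>g. f \<cdot> g) (Hom C X A) (Hom C X B)"
  shows "iso C f"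
proof -
  have A: "A \<in> Obj C" and B: "B \<in> Obj C"
    using Hom_Obj[OF f] .
  obtain g where g: "g \<in> Hom C B A" and fg: "f \<cdot> g = Ident C B"
    using bij_betw_imp_surj_on[OF bij[OF B]] Ident_Hom[OF B] by (metis imageE)
  have "f \<cdot> (g \<cdot> f) = f \<cdot> Ident C A"
    using Comp_assoc[OF f g f] fg Ident_Comp[OF f] Comp_Ident[OF f] by simp
  then have "g \<cdot> f = Ident C A"
    using bij_betw_imp_inj_on[OF bij[OF A]] Comp_Hom[OF f g] Ident_Hom[OF A]
    by (auto dest: inj_onD)
  then show ?thesis
    using isoI[OF f g] fg by simp
qed

lemma inverse_natural:
  assumes "iso C a" "a \<in> Hom C A B" "iso C a'" "a' \<in> Hom C A' B'"
    and "f \<in> Hom C A A'" "g \<in> Hom C B B'" "a' \<cdot> f = g \<cdot> a"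
  shows "f \<cdot> inverse_arr C a = inverse_arr C a' \<cdot> g"
proof -
  note ia = inverse_arr_Hom[OF assms(1,2)] and ia' = inverse_arr_Hom[OF assms(3,4)]
  have "f \<cdot> inverse_arr C a = ((inverse_arr C a' \<cdot> a') \<cdot> f) \<cdot> inverse_arr C a"
    using inverse_arr_Comp[OF assms(3,4)] Ident_Comp[OF assms(5)] by simp
  also have "\<dots> = ((inverse_arr C a' \<cdot> g) \<cdot> a) \<cdot> inverse_arr C a"
    using Comp_assoc[OF assms(5,4) ia'] Comp_assoc[OF assms(2,6) ia'] assms(7) by simp
  also have "\<dots> = inverse_arr C a' \<cdot> g"
    using Comp_inverse_cancel[OF assms(1,2) Comp_Hom[OF assms(6) ia']] .
  finally show ?thesis .
qed

end

lemma (in monoidal_category) tensor_iso: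
  assumes f: "iso C f" "f \<in> Hom C A A'" and g: "iso C g" "g \<in> Hom C B B'"
  shows "iso C (f \<odot> g)"
proof (rule isoI)
  note if' = inverse_arr_Hom[OF f] and ig = inverse_arr_Hom[OF g]
  note objs = Hom_Obj[OF f(2)] Hom_Obj[OF g(2)]
  show "f \<odot> g \<in> Hom C (A \<otimes> B) (A' \<otimes> B')"
    using tensor_Hom[OF f(2) g(2)] .
  show "inverse_arr C f \<odot> inverse_arr C g \<in> Hom C (A' \<otimes> B') (A \<otimes> B)"
    using tensor_Hom[OF if' ig] .
  show "(inverse_arr C f \<odot> inverse_arr C g) \<cdot> (f \<odot> g) = Ident C (A \<otimes> B)"
    using tensor_Comp[OF f(2) if' g(2) ig] inverse_arr_Comp[OF f] inverse_arr_Comp[OF g]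
      tensor_Ident objs by simp
  show "(f \<odot> g) \<cdot> (inverse_arr C f \<odot> inverse_arr C g) = Ident C (A' \<otimes> B')"
    using tensor_Comp[OF if' f(2) ig g(2)] Comp_inverse_arr[OF f] Comp_inverse_arr[OF g]
      tensor_Ident objs by simp
qed

section \<open>Currying\<close>

context biclosed_monoidal_category
begin

lemma lcurry_Hom:
  assumes "W \<in> Obj C" "V \<in> Obj C" "N \<in> Obj C" "f \<in> Hom C (W \<otimes> V) N"
  shows "lcurry C W V N f \<in> Hom C W (V \<triangleright> N)"
  using bij_betw_apply[OF lcurry_bij[OF assms(1-3)] assms(4)] by (simp add: lact_def)

lemma rcurry_Hom:
  assumes "V \<in> Obj C" "W \<in> Obj C" "N \<in> Obj C" "f \<in> Hom C (V \<otimes> W) N"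
  shows "rcurry C V W N f \<in> Hom C W (N \<triangleleft> V)"
  using bij_betw_apply[OF rcurry_bij[OF assms(1-3)] assms(4)] by (simp add: ract_def)

lemma luncurry:
  assumes "W \<in> Obj C" "V \<in> Obj C" "N \<in> Obj C" "g \<in> Hom C W (V \<triangleright> N)"
  shows luncurry_Hom: "luncurry C W V N g \<in> Hom C (W \<otimes> V) N"
    and lcurry_luncurry: "lcurry C W V N (luncurry C W V N g) = g"
proof -
  have g: "g \<in> lcurry C W V N ` Hom C (W \<otimes> V) N"
    using bij_betw_imp_surj_on[OF lcurry_bij[OF assms(1-3)]] assms(4) by (simp add: lact_def)
  show "luncurry C W V N g \<in> Hom C (W \<otimes> V) N"
    unfolding luncurry_def using inv_into_into[OF g] .
  show "lcurry C W V N (luncurry C W V N g) = g"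
    unfolding luncurry_def using f_inv_into_f[OF g] .
qed

lemma runcurry:
  assumes "V \<in> Obj C" "W \<in> Obj C" "N \<in> Obj C" "g \<in> Hom C W (N \<triangleleft> V)"
  shows runcurry_Hom: "runcurry C V W N g \<in> Hom C (V \<otimes> W) N"
    and rcurry_runcurry: "rcurry C V W N (runcurry C V W N g) = g"
proof -
  have g: "g \<in> rcurry C V W N ` Hom C (V \<otimes> W) N"
    using bij_betw_imp_surj_on[OF rcurry_bij[OF assms(1-3)]] assms(4) by (simp add: ract_def)
  show "runcurry C V W N g \<in> Hom C (V \<otimes> W) N"
    unfolding runcurry_def using inv_into_into[OF g] .
  show "rcurry C V W N (runcurry C V W N g) = g"
    unfolding runcurry_def using f_inv_into_f[OF g] .
qed

lemma luncurry_lcurry: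
  assumes "W \<in> Obj C" "V \<in> Obj C" "N \<in> Obj C" "f \<in> Hom C (W \<otimes> V) N"
  shows "luncurry C W V N (lcurry C W V N f) = f"
  using bij_betw_inv_into_left[OF lcurry_bij[OF assms(1-3)] assms(4)]
  by (simp add: luncurry_def)

lemma runcurry_rcurry:
  assumes "V \<in> Obj C" "W \<in> Obj C" "N \<in> Obj C" "f \<in> Hom C (V \<otimes> W) N"
  shows "runcurry C V W N (rcurry C V W N f) = f"
  using bij_betw_inv_into_left[OF rcurry_bij[OF assms(1-3)] assms(4)]
  by (simp add: runcurry_def)

lemma luncurry_bij:
  assumes "W \<in> Obj C" "V \<in> Obj C" "N \<in> Obj C"
  shows "bij_betw (luncurry C W V N) (Hom C W (V \<triangleright> N)) (Hom C (W \<otimes> V) N)"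
  using bij_betw_inv_into[OF lcurry_bij[OF assms]] by (simp add: luncurry_def[abs_def] lact_def)

lemma lact_Obj: "V \<in> Obj C \<Longrightarrow> N \<in> Obj C \<Longrightarrow> V \<triangleright> N \<in> Obj C"
  by (simp add: lact_def lhom_Obj)

lemma ract_Obj: "V \<in> Obj C \<Longrightarrow> N \<in> Obj C \<Longrightarrow> N \<triangleleft> V \<in> Obj C"
  by (simp add: ract_def rhom_Obj)

lemma lcurry_precomp:
  assumes f: "f \<in> Hom C (W \<otimes> V) N" and w: "w \<in> Hom C W' W"
    and V: "V \<in> Obj C" and N: "N \<in> Obj C"
  shows "lcurry C W' V N (f \<cdot> (w \<odot> Ident C V)) = lcurry C W V N f \<cdot> w"
proof -
  have W: "W \<in> Obj C"
    using Hom_Obj[OF w] by simp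
  have l: "lcurry C W V N f \<in> Hom C W (lhom C V N)"
    using lcurry_Hom[OF W V N f] by (simp add: lact_def)
  show ?thesis
    using lcurry_natural[OF w Ident_Hom[OF V] Ident_Hom[OF N] f]
      Ident_Comp[OF f] lhom_Ident[OF V N] Ident_Comp[OF l] by simp
qed

lemma rcurry_precomp:
  assumes f: "f \<in> Hom C (V \<otimes> W) N" and w: "w \<in> Hom C W' W"
    and V: "V \<in> Obj C" and N: "N \<in> Obj C"
  shows "rcurry C V W' N (f \<cdot> (Ident C V \<odot> w)) = rcurry C V W N f \<cdot> w"
proof -
  have W: "W \<in> Obj C"
    using Hom_Obj[OF w] by simp
  have l: "rcurry C V W N f \<in> Hom C W (rhom C V N)"
    using rcurry_Hom[OF V W N f] by (simp add: ract_def)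
  show ?thesis
    using rcurry_natural[OF Ident_Hom[OF V] w Ident_Hom[OF N] f]
      Ident_Comp[OF f] rhom_Ident[OF V N] Ident_Comp[OF l] by simp
qed

lemma luncurry_precomp:
  assumes g: "g \<in> Hom C W (V \<triangleright> N)" and w: "w \<in> Hom C W' W"
    and V: "V \<in> Obj C" and N: "N \<in> Obj C"
  shows "luncurry C W' V N (g \<cdot> w) = luncurry C W V N g \<cdot> (w \<odot> Ident C V)"
proof -
  have W: "W' \<in> Obj C" "W \<in> Obj C"
    using Hom_Obj[OF w] by simp_all
  note u = luncurry_Hom[OF W(2) V N g]
  show ?thesis
    using lcurry_precomp[OF u w V N] lcurry_luncurry[OF W(2) V N g]
      luncurry_lcurry[OF W(1) V N Comp_Hom[OF tensor_Hom[OF w Ident_Hom[OF V]] u]] by simp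
qed

lemma runcurry_precomp:
  assumes g: "g \<in> Hom C W (N \<triangleleft> V)" and w: "w \<in> Hom C W' W"
    and V: "V \<in> Obj C" and N: "N \<in> Obj C"
  shows "runcurry C V W' N (g \<cdot> w) = runcurry C V W N g \<cdot> (Ident C V \<odot> w)"
proof -
  have W: "W' \<in> Obj C" "W \<in> Obj C"
    using Hom_Obj[OF w] by simp_all
  note u = runcurry_Hom[OF V W(2) N g]
  show ?thesis
    using rcurry_precomp[OF u w V N] rcurry_runcurry[OF V W(2) N g]
      runcurry_rcurry[OF V W(1) N Comp_Hom[OF tensor_Hom[OF Ident_Hom[OF V] w] u]] by simp
qed

lemma lcurry_postcomp:
  assumes f: "f \<in> Hom C (W \<otimes> V) N" and m: "m \<in> Hom C N N'"
    and W: "W \<in> Obj C" and V: "V \<in> Obj C"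
  shows "lcurry C W V N' (m \<cdot> f) = lact_arr C V m \<cdot> lcurry C W V N f"
proof -
  have N: "N \<in> Obj C" "N' \<in> Obj C"
    using Hom_Obj[OF m] by simp_all
  have l: "lact_arr C V m \<cdot> lcurry C W V N f \<in> Hom C W (lhom C V N')"
    unfolding lact_arr_def
    using Comp_Hom[OF _ lhom_Hom[OF Ident_Hom[OF V] m]] lcurry_Hom[OF W V N(1) f]
    by (simp add: lact_def)
  show ?thesis
    using lcurry_natural[OF Ident_Hom[OF W] Ident_Hom[OF V] m f]
      tensor_Ident[OF W V] Comp_Ident[OF Comp_Hom[OF f m]] Comp_Ident[OF l]
    by (simp add: lact_arr_def)
qed

lemma rcurry_postcomp:
  assumes f: "f \<in> Hom C (V \<otimes> W) N" and m: "m \<in> Hom C N N'"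
    and W: "W \<in> Obj C" and V: "V \<in> Obj C"
  shows "rcurry C V W N' (m \<cdot> f) = ract_arr C m V \<cdot> rcurry C V W N f"
proof -
  have N: "N \<in> Obj C" "N' \<in> Obj C"
    using Hom_Obj[OF m] by simp_all
  have l: "ract_arr C m V \<cdot> rcurry C V W N f \<in> Hom C W (rhom C V N')"
    unfolding ract_arr_def
    using Comp_Hom[OF _ rhom_Hom[OF Ident_Hom[OF V] m]] rcurry_Hom[OF V W N(1) f]
    by (simp add: ract_def)
  show ?thesis
    using rcurry_natural[OF Ident_Hom[OF V] Ident_Hom[OF W] m f]
      tensor_Ident[OF V W] Comp_Ident[OF Comp_Hom[OF f m]] Comp_Ident[OF l]
    by (simp add: ract_arr_def)
qed


section \<open>Constraints of the contragradient bimodule category\<close>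

lemma lact_arr_Hom:
  assumes "V \<in> Obj C" "f \<in> Hom C N N'"
  shows "lact_arr C V f \<in> Hom C (V \<triangleright> N) (V \<triangleright> N')"
  unfolding lact_arr_def lact_def using lhom_Hom[OF Ident_Hom[OF assms(1)] assms(2)] .

lemma ract_arr_Hom:
  assumes "V \<in> Obj C" "f \<in> Hom C N N'"
  shows "ract_arr C f V \<in> Hom C (N \<triangleleft> V) (N' \<triangleleft> V)"
  unfolding ract_arr_def ract_def using rhom_Hom[OF Ident_Hom[OF assms(1)] assms(2)] .

lemma lact_assoc_Hom:
  assumes "V \<in> Obj C" "W \<in> Obj C" "N \<in> Obj C"
  shows "lact_assoc C V W N \<in> Hom C (V \<triangleright> (W \<triangleright> N)) ((V \<otimes> W) \<triangleright> N)"
proof -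
  let ?A = "V \<triangleright> (W \<triangleright> N)"
  note objs = assms tensor_Obj lact_Obj ract_Obj
  have A: "?A \<in> Obj C"
    by (simp add: objs)
  have u: "luncurry C ?A V (W \<triangleright> N) (Ident C ?A) \<in> Hom C (?A \<otimes> V) (W \<triangleright> N)"
    by (rule luncurry_Hom) (simp_all add: objs Ident_Hom)
  have v: "luncurry C (?A \<otimes> V) W N (luncurry C ?A V (W \<triangleright> N) (Ident C ?A))
      \<in> Hom C (?A \<otimes> V \<otimes> W) N"
    by (rule luncurry_Hom) (simp_all add: objs u)
  show ?thesis
    unfolding lact_assoc_def yoneda_def
    by (rule lcurry_Hom)
      (use objs Comp_Hom[OF inverse_arr_Hom[OF assoc_iso[OF A assms(1,2)]
            assoc_Hom[OF A assms(1,2)]] v] in simp_all)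
qed

lemma mid_assoc_Hom:
  assumes "V \<in> Obj C" "W \<in> Obj C" "N \<in> Obj C"
  shows "mid_assoc C V N W \<in> Hom C (V \<triangleright> (N \<triangleleft> W)) ((V \<triangleright> N) \<triangleleft> W)"
proof -
  let ?A = "V \<triangleright> (N \<triangleleft> W)"
  note objs = assms tensor_Obj lact_Obj ract_Obj
  have A: "?A \<in> Obj C"
    by (simp add: objs)
  have u: "luncurry C ?A V (N \<triangleleft> W) (Ident C ?A) \<in> Hom C (?A \<otimes> V) (N \<triangleleft> W)"
    by (rule luncurry_Hom) (simp_all add: objs Ident_Hom)
  have v: "runcurry C W (?A \<otimes> V) N (luncurry C ?A V (N \<triangleleft> W) (Ident C ?A))
      \<in> Hom C (W \<otimes> (?A \<otimes> V)) N"
    by (rule runcurry_Hom) (simp_all add: objs u)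
  show ?thesis
    unfolding mid_assoc_def yoneda_def
    by (intro rcurry_Hom lcurry_Hom)
      (use objs Comp_Hom[OF assoc_Hom[OF assms(2) A assms(1)] v] in simp_all)
qed

lemma ract_assoc_Hom:
  assumes "V \<in> Obj C" "W \<in> Obj C" "N \<in> Obj C"
  shows "ract_assoc C N V W \<in> Hom C (N \<triangleleft> (V \<otimes> W)) ((N \<triangleleft> V) \<triangleleft> W)"
proof -
  let ?A = "N \<triangleleft> (V \<otimes> W)"
  note objs = assms tensor_Obj lact_Obj ract_Obj
  have A: "?A \<in> Obj C"
    by (simp add: objs)
  have v: "runcurry C (V \<otimes> W) ?A N (Ident C ?A) \<in> Hom C (V \<otimes> W \<otimes> ?A) N"
    by (rule runcurry_Hom) (simp_all add: objs Ident_Hom)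
  show ?thesis
    unfolding ract_assoc_def yoneda_def
    by (intro rcurry_Hom)
      (use objs Comp_Hom[OF inverse_arr_Hom[OF assoc_iso[OF assms(1,2) A]
            assoc_Hom[OF assms(1,2) A]] v] in simp_all)
qed

text \<open>
  The associativity constraints are defined by evaluating a family of maps of Hom sets at an
  identity arrow. As these families are natural, composition with the constraint is the map
  at every object; this is stated on curried arrows.
\<close>

lemma yoneda_Comp:
  assumes "f \<in> Hom C X A" "\<Phi> X (Ident C A \<cdot> f) = \<Phi> A (Ident C A) \<cdot> f"
  shows "yoneda C A \<Phi> \<cdot> f = \<Phi> X f"
  using assms Ident_Comp[OF assms(1)] by (simp add: yoneda_def)

lemma lact_assoc_Comp_lcurry:
  assumes X: "X \<in> Obj C" and V: "V \<in> Obj C" and W: "W \<in> Obj C" and N: "N \<in> Obj C"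
    and f: "f \<in> Hom C (X \<otimes> V \<otimes> W) N"
  shows "lact_assoc C V W N \<cdot> lcurry C X V (W \<triangleright> N) (lcurry C (X \<otimes> V) W N f) =
    lcurry C X (V \<otimes> W) N (f \<cdot> inverse_arr C (\<a> X V W))"
proof -
  note objs = X V W N tensor_Obj lact_Obj ract_Obj
  let ?A = "V \<triangleright> (W \<triangleright> N)"
  let ?\<Phi> = "\<lambda>X f. lcurry C X (V \<otimes> W) N
    (luncurry C (X \<otimes> V) W N (luncurry C X V (W \<triangleright> N) f) \<cdot> inverse_arr C (\<a> X V W))"
  let ?g = "lcurry C (X \<otimes> V) W N f" and ?h = "lcurry C X V (W \<triangleright> N) (lcurry C (X \<otimes> V) W N f)"
  have A: "?A \<in> Obj C" and VW: "V \<otimes> W \<in> Obj C"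
    by (simp_all add: objs)
  have g: "?g \<in> Hom C (X \<otimes> V) (W \<triangleright> N)"
    by (rule lcurry_Hom) (simp_all add: objs f)
  have h: "?h \<in> Hom C X ?A"
    by (rule lcurry_Hom) (simp_all add: objs g)
  define u where "u = luncurry C ?A V (W \<triangleright> N) (Ident C ?A)"
  have u: "u \<in> Hom C (?A \<otimes> V) (W \<triangleright> N)"
    unfolding u_def by (rule luncurry_Hom) (simp_all add: objs Ident_Hom A)
  define v where "v = luncurry C (?A \<otimes> V) W N u"
  have v: "v \<in> Hom C (?A \<otimes> V \<otimes> W) N"
    unfolding v_def by (rule luncurry_Hom) (simp_all add: objs u)
  note hV = tensor_Hom[OF h Ident_Hom[OF V]]
  note hVW = tensor_Hom[OF hV Ident_Hom[OF W]]
  have hVW': "?h \<odot> Ident C (V \<otimes> W) \<in> Hom C (X \<otimes> (V \<otimes> W)) (?A \<otimes> (V \<otimes> W))"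
    using tensor_Hom[OF h Ident_Hom[OF VW]] .
  note iX = inverse_arr_Hom[OF assoc_iso[OF X V W] assoc_Hom[OF X V W]]
  note iA = inverse_arr_Hom[OF assoc_iso[OF A V W] assoc_Hom[OF A V W]]
  have nat: "(?h \<odot> Ident C V \<odot> Ident C W) \<cdot> inverse_arr C (\<a> X V W) =
      inverse_arr C (\<a> ?A V W) \<cdot> (?h \<odot> Ident C (V \<otimes> W))"
    using inverse_natural[OF assoc_iso[OF X V W] assoc_Hom[OF X V W]
        assoc_iso[OF A V W] assoc_Hom[OF A V W] hVW hVW']
      assoc_natural[OF h Ident_Hom[OF V] Ident_Hom[OF W]] tensor_Ident[OF V W] by simp
  have "?\<Phi> X (Ident C ?A \<cdot> ?h) =
      lcurry C X (V \<otimes> W) N ((v \<cdot> (?h \<odot> Ident C V \<odot> Ident C W)) \<cdot> inverse_arr C (\<a> X V W))"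
    using luncurry_precomp[OF Ident_Hom[OF A] h V lact_Obj[OF W N]]
      luncurry_precomp[OF u hV W N] by (simp add: u_def v_def)
  also have "\<dots> = lcurry C X (V \<otimes> W) N
      ((v \<cdot> inverse_arr C (\<a> ?A V W)) \<cdot> (?h \<odot> Ident C (V \<otimes> W)))"
    using Comp_assoc[OF iX hVW v] Comp_assoc[OF hVW' iA v] nat by simp
  also have "\<dots> = ?\<Phi> ?A (Ident C ?A) \<cdot> ?h"
    using lcurry_precomp[OF Comp_Hom[OF iA v] h VW N] by (simp add: u_def v_def)
  finally have "lact_assoc C V W N \<cdot> ?h = ?\<Phi> X ?h"
    unfolding lact_assoc_def by (rule yoneda_Comp[OF h])
  then show ?thesis
    using luncurry_lcurry[OF X V lact_Obj[OF W N] g]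
      luncurry_lcurry[OF tensor_Obj[OF X V] W N f] by simp
qed

lemma mid_assoc_Comp_lcurry:
  assumes X: "X \<in> Obj C" and V: "V \<in> Obj C" and W: "W \<in> Obj C" and N: "N \<in> Obj C"
    and f: "f \<in> Hom C (W \<otimes> (X \<otimes> V)) N"
  shows "mid_assoc C V N W \<cdot> lcurry C X V (N \<triangleleft> W) (rcurry C W (X \<otimes> V) N f) =
    rcurry C W X (V \<triangleright> N) (lcurry C (W \<otimes> X) V N (f \<cdot> \<a> W X V))"
proof -
  note objs = X V W N tensor_Obj lact_Obj ract_Obj
  let ?A = "V \<triangleright> (N \<triangleleft> W)"
  let ?\<Phi> = "\<lambda>X f. rcurry C W X (V \<triangleright> N) (lcurry C (W \<otimes> X) V N
    (runcurry C W (X \<otimes> V) N (luncurry C X V (N \<triangleleft> W) f) \<cdot> \<a> W X V))"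
  let ?g = "rcurry C W (X \<otimes> V) N f" and ?h = "lcurry C X V (N \<triangleleft> W) (rcurry C W (X \<otimes> V) N f)"
  have A: "?A \<in> Obj C" and WA: "W \<otimes> ?A \<in> Obj C"
    by (simp_all add: objs)
  have g: "?g \<in> Hom C (X \<otimes> V) (N \<triangleleft> W)"
    by (rule rcurry_Hom) (simp_all add: objs f)
  have h: "?h \<in> Hom C X ?A"
    by (rule lcurry_Hom) (simp_all add: objs g)
  define u where "u = luncurry C ?A V (N \<triangleleft> W) (Ident C ?A)"
  have u: "u \<in> Hom C (?A \<otimes> V) (N \<triangleleft> W)"
    unfolding u_def by (rule luncurry_Hom) (simp_all add: objs Ident_Hom A)
  define v where "v = runcurry C W (?A \<otimes> V) N u"
  have v: "v \<in> Hom C (W \<otimes> (?A \<otimes> V)) N"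
    unfolding v_def by (rule runcurry_Hom) (simp_all add: objs u)
  note hV = tensor_Hom[OF h Ident_Hom[OF V]]
  note WhV = tensor_Hom[OF Ident_Hom[OF W] hV]
  note Wh = tensor_Hom[OF Ident_Hom[OF W] h]
  note WhV' = tensor_Hom[OF Wh Ident_Hom[OF V]]
  note aX = assoc_Hom[OF W X V] and aA = assoc_Hom[OF W A V]
  note va = Comp_Hom[OF aA v]
  have l: "lcurry C (W \<otimes> ?A) V N (v \<cdot> \<a> W ?A V) \<in> Hom C (W \<otimes> ?A) (V \<triangleright> N)"
    by (rule lcurry_Hom) (simp_all add: objs va)
  have "?\<Phi> X (Ident C ?A \<cdot> ?h) = rcurry C W X (V \<triangleright> N) (lcurry C (W \<otimes> X) V N
      ((v \<cdot> (Ident C W \<odot> (?h \<odot> Ident C V))) \<cdot> \<a> W X V))"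
    using luncurry_precomp[OF Ident_Hom[OF A] h V ract_Obj[OF W N]]
      runcurry_precomp[OF u hV W N] by (simp add: u_def v_def)
  also have "\<dots> = rcurry C W X (V \<triangleright> N) (lcurry C (W \<otimes> X) V N
      ((v \<cdot> \<a> W ?A V) \<cdot> (Ident C W \<odot> ?h \<odot> Ident C V)))"
    using Comp_assoc[OF aX WhV v] Comp_assoc[OF WhV' aA v]
      assoc_natural[OF Ident_Hom[OF W] h Ident_Hom[OF V]] by simp
  also have "\<dots> = ?\<Phi> ?A (Ident C ?A) \<cdot> ?h"
    using lcurry_precomp[OF va Wh V N] rcurry_precomp[OF l h W lact_Obj[OF V N]]
    by (simp add: u_def v_def)
  finally have "mid_assoc C V N W \<cdot> ?h = ?\<Phi> X ?h"
    unfolding mid_assoc_def by (rule yoneda_Comp[OF h])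
  then show ?thesis
    using luncurry_lcurry[OF X V ract_Obj[OF W N] g]
      runcurry_rcurry[OF W tensor_Obj[OF X V] N f] by simp
qed

lemma ract_assoc_Comp_rcurry:
  assumes X: "X \<in> Obj C" and V: "V \<in> Obj C" and W: "W \<in> Obj C" and N: "N \<in> Obj C"
    and f: "f \<in> Hom C (V \<otimes> W \<otimes> X) N"
  shows "ract_assoc C N V W \<cdot> rcurry C (V \<otimes> W) X N f =
    rcurry C W X (N \<triangleleft> V) (rcurry C V (W \<otimes> X) N (f \<cdot> inverse_arr C (\<a> V W X)))"
proof -
  note objs = X V W N tensor_Obj lact_Obj ract_Obj
  let ?A = "N \<triangleleft> (V \<otimes> W)"
  let ?\<Phi> = "\<lambda>X f. rcurry C W X (N \<triangleleft> V) (rcurry C V (W \<otimes> X) N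
    (runcurry C (V \<otimes> W) X N f \<cdot> inverse_arr C (\<a> V W X)))"
  let ?h = "rcurry C (V \<otimes> W) X N f"
  have A: "?A \<in> Obj C" and VW: "V \<otimes> W \<in> Obj C"
    by (simp_all add: objs)
  have h: "?h \<in> Hom C X ?A"
    by (rule rcurry_Hom) (simp_all add: objs f)
  define v where "v = runcurry C (V \<otimes> W) ?A N (Ident C ?A)"
  have v: "v \<in> Hom C (V \<otimes> W \<otimes> ?A) N"
    unfolding v_def by (rule runcurry_Hom) (simp_all add: objs Ident_Hom A)
  note Wh = tensor_Hom[OF Ident_Hom[OF W] h]
  note VWh = tensor_Hom[OF Ident_Hom[OF V] Wh]
  note VWh' = tensor_Hom[OF Ident_Hom[OF VW] h]
  note iX = inverse_arr_Hom[OF assoc_iso[OF V W X] assoc_Hom[OF V W X]]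
  note iA = inverse_arr_Hom[OF assoc_iso[OF V W A] assoc_Hom[OF V W A]]
  note vi = Comp_Hom[OF iA v]
  have l: "rcurry C V (W \<otimes> ?A) N (v \<cdot> inverse_arr C (\<a> V W ?A)) \<in> Hom C (W \<otimes> ?A) (N \<triangleleft> V)"
    by (rule rcurry_Hom) (simp_all add: objs vi)
  have nat: "(Ident C (V \<otimes> W) \<odot> ?h) \<cdot> inverse_arr C (\<a> V W X) =
      inverse_arr C (\<a> V W ?A) \<cdot> (Ident C V \<odot> (Ident C W \<odot> ?h))"
    using inverse_natural[OF assoc_iso[OF V W X] assoc_Hom[OF V W X]
        assoc_iso[OF V W A] assoc_Hom[OF V W A] VWh' VWh]
      assoc_natural[OF Ident_Hom[OF V] Ident_Hom[OF W] h] tensor_Ident[OF V W] by simp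
  have "?\<Phi> X (Ident C ?A \<cdot> ?h) = rcurry C W X (N \<triangleleft> V) (rcurry C V (W \<otimes> X) N
      ((v \<cdot> (Ident C (V \<otimes> W) \<odot> ?h)) \<cdot> inverse_arr C (\<a> V W X)))"
    using runcurry_precomp[OF Ident_Hom[OF A] h VW N] by (simp add: v_def)
  also have "\<dots> = rcurry C W X (N \<triangleleft> V) (rcurry C V (W \<otimes> X) N
      ((v \<cdot> inverse_arr C (\<a> V W ?A)) \<cdot> (Ident C V \<odot> (Ident C W \<odot> ?h))))"
    using Comp_assoc[OF iX VWh' v] Comp_assoc[OF VWh iA v] nat by simp
  also have "\<dots> = ?\<Phi> ?A (Ident C ?A) \<cdot> ?h"
    using rcurry_precomp[OF vi Wh V N] rcurry_precomp[OF l h W ract_Obj[OF V N]]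
    by (simp add: v_def)
  finally have "ract_assoc C N V W \<cdot> ?h = ?\<Phi> X ?h"
    unfolding ract_assoc_def by (rule yoneda_Comp[OF h])
  then show ?thesis
    using runcurry_rcurry[OF VW X N f] by simp
qed

end


section \<open>Half-braidings as rotations of Hom sets\<close>

text \<open>An object \<open>(M, \<tau>)\<close> of the weak center of the contragradient bimodule category.\<close>

locale weak_central_object = biclosed_monoidal_category C
  for C :: "('o, 'a, 'm) biclosed_data_scheme" (structure) +
  fixes M :: 'o and \<tau> :: "'o \<Rightarrow> 'a"
  assumes weak_central: "(M, \<tau>) \<in> weak_center C"
begin

lemma M_Obj: "M \<in> Obj C"
  using weak_central by (simp add: weak_center_def)

lemma tau_Hom: "V \<in> Obj C \<Longrightarrow> \<tau> V \<in> Hom C (V \<triangleright> M) (M \<triangleleft> V)"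
  using weak_central by (simp add: weak_center_def)

lemma tau_natural:
  "f \<in> Hom C V V' \<Longrightarrow>
    \<tau> V \<cdot> lhom_arr C f (Ident C M) = rhom_arr C f (Ident C M) \<cdot> \<tau> V'"
  using weak_central Hom_Obj[of f V V'] by (simp add: weak_center_def)

lemma tau_hexagon:
  "V \<in> Obj C \<Longrightarrow> W \<in> Obj C \<Longrightarrow>
    ract_arr C (\<tau> V) W \<cdot> mid_assoc C V M W \<cdot> lact_arr C V (\<tau> W) =
    ract_assoc C M V W \<cdot> \<tau> (V \<otimes> W) \<cdot> lact_assoc C V W M"
  using weak_central by (simp add: weak_center_def)

text \<open>
  The map \<open>Hom(X \<otimes> V, M) \<simeq> Hom(X, V \<triangleright> M) \<rightarrow> Hom(X, M \<triangleleft> V) \<simeq> Hom(V \<otimes> X, M)\<close> given by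
  composition with \<open>\<tau> V\<close>; it moves the factor \<open>V\<close> from the right end to the left end.
\<close>

definition rot :: "'o \<Rightarrow> 'o \<Rightarrow> 'a \<Rightarrow> 'a" where
  "rot X V f = runcurry C V X M (\<tau> V \<cdot> lcurry C X V M f)"

lemma tau_lcurry_Hom:
  assumes "X \<in> Obj C" "V \<in> Obj C" "f \<in> Hom C (X \<otimes> V) M"
  shows "\<tau> V \<cdot> lcurry C X V M f \<in> Hom C X (M \<triangleleft> V)"
  using Comp_Hom[OF lcurry_Hom[OF assms(1,2) M_Obj assms(3)] tau_Hom[OF assms(2)]] .

lemma rot_Hom:
  assumes "X \<in> Obj C" "V \<in> Obj C" "f \<in> Hom C (X \<otimes> V) M"
  shows "rot X V f \<in> Hom C (V \<otimes> X) M"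
  unfolding rot_def using runcurry_Hom[OF assms(2,1) M_Obj tau_lcurry_Hom[OF assms]] .

lemma rcurry_rot:
  assumes "X \<in> Obj C" "V \<in> Obj C" "f \<in> Hom C (X \<otimes> V) M"
  shows "rcurry C V X M (rot X V f) = \<tau> V \<cdot> lcurry C X V M f"
  unfolding rot_def using rcurry_runcurry[OF assms(2,1) M_Obj tau_lcurry_Hom[OF assms]] .

lemma rot_natural:
  assumes x: "x \<in> Hom C X' X" and v: "v \<in> Hom C V' V" and f: "f \<in> Hom C (X \<otimes> V) M"
  shows "rot X' V' (f \<cdot> (x \<odot> v)) = rot X V f \<cdot> (v \<odot> x)"
proof -
  have X: "X \<in> Obj C" and X': "X' \<in> Obj C" and V: "V \<in> Obj C" and V': "V' \<in> Obj C"
    using Hom_Obj[OF x] Hom_Obj[OF v] by auto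
  let ?id = "Ident C M"
  note id = Ident_Hom[OF M_Obj]
  have l: "lcurry C X V M f \<in> Hom C X (V \<triangleright> M)"
    using lcurry_Hom[OF X V M_Obj f] .
  have lv: "lhom_arr C v ?id \<in> Hom C (V \<triangleright> M) (V' \<triangleright> M)"
    using lhom_Hom[OF v id] by (simp add: lact_def)
  have rv: "rhom_arr C v ?id \<in> Hom C (M \<triangleleft> V) (M \<triangleleft> V')"
    using rhom_Hom[OF v id] by (simp add: ract_def)
  note r = rot_Hom[OF X V f]
  have "\<tau> V' \<cdot> lcurry C X' V' M (f \<cdot> (x \<odot> v)) =
      \<tau> V' \<cdot> (lhom_arr C v ?id \<cdot> lcurry C X V M f \<cdot> x)"
    using lcurry_natural[OF x v id f] Ident_Comp[OF f] by simp
  also have "\<dots> = (\<tau> V' \<cdot> lhom_arr C v ?id) \<cdot> lcurry C X V M f \<cdot> x"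
    using Comp_assoc[OF x Comp_Hom[OF l lv] tau_Hom[OF V']]
      Comp_assoc[OF l lv tau_Hom[OF V']] by simp
  also have "\<dots> = rhom_arr C v ?id \<cdot> rcurry C V X M (rot X V f) \<cdot> x"
    using tau_natural[OF v] Comp_assoc[OF l tau_Hom[OF V] rv] rcurry_rot[OF X V f] by simp
  also have "\<dots> = rcurry C V' X' M (rot X V f \<cdot> (v \<odot> x))"
    using rcurry_natural[OF v x id r] Ident_Comp[OF r] by simp
  finally show ?thesis
    unfolding rot_def[of X' V']
    using runcurry_rcurry[OF V' X' M_Obj Comp_Hom[OF tensor_Hom[OF v x] r]] by simp
qed

text \<open>The hexagon axiom: moving \<open>V \<otimes> W\<close> is moving first \<open>W\<close> and then \<open>V\<close>.\<close>

lemma rot_hexagon: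
  assumes X: "X \<in> Obj C" and V: "V \<in> Obj C" and W: "W \<in> Obj C"
    and f: "f \<in> Hom C (X \<otimes> V \<otimes> W) M"
  shows "rot (W \<otimes> X) V (rot (X \<otimes> V) W f \<cdot> \<a> W X V) =
    rot X (V \<otimes> W) (f \<cdot> inverse_arr C (\<a> X V W)) \<cdot> inverse_arr C (\<a> V W X)"
proof -
  note objs = X V W M_Obj tensor_Obj lact_Obj ract_Obj
  have XV: "X \<otimes> V \<in> Obj C" and VW: "V \<otimes> W \<in> Obj C" and WX: "W \<otimes> X \<in> Obj C"
    by (simp_all add: objs)
  let ?g = "lcurry C (X \<otimes> V) W M f"
  define h where "h = lcurry C X V (W \<triangleright> M) ?g"
  have g: "?g \<in> Hom C (X \<otimes> V) (W \<triangleright> M)"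
    by (rule lcurry_Hom) (simp_all add: objs f)
  have h: "h \<in> Hom C X (V \<triangleright> (W \<triangleright> M))"
    unfolding h_def by (rule lcurry_Hom) (simp_all add: objs g)
  define p where "p = rot (X \<otimes> V) W f"
  have p: "p \<in> Hom C (W \<otimes> (X \<otimes> V)) M"
    unfolding p_def by (rule rot_Hom[OF XV W f])
  note pa = Comp_Hom[OF assoc_Hom[OF W X V] p]
  have fi: "f \<cdot> inverse_arr C (\<a> X V W) \<in> Hom C (X \<otimes> (V \<otimes> W)) M"
    using Comp_Hom[OF inverse_arr_Hom[OF assoc_iso[OF X V W] assoc_Hom[OF X V W]] f] .
  define q where "q = rot X (V \<otimes> W) (f \<cdot> inverse_arr C (\<a> X V W))"
  have q: "q \<in> Hom C (V \<otimes> W \<otimes> X) M"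
    unfolding q_def by (rule rot_Hom[OF X VW fi])
  have qi: "q \<cdot> inverse_arr C (\<a> V W X) \<in> Hom C (V \<otimes> (W \<otimes> X)) M"
    using Comp_Hom[OF inverse_arr_Hom[OF assoc_iso[OF V W X] assoc_Hom[OF V W X]] q] .
  have left: "ract_arr C (\<tau> V) W \<cdot> (mid_assoc C V M W \<cdot> (lact_arr C V (\<tau> W) \<cdot> h)) =
      rcurry C W X (M \<triangleleft> V) (rcurry C V (W \<otimes> X) M (rot (W \<otimes> X) V (p \<cdot> \<a> W X V)))"
  proof -
    have "lact_arr C V (\<tau> W) \<cdot> h = lcurry C X V (M \<triangleleft> W) (rcurry C W (X \<otimes> V) M p)"
      unfolding h_def p_def
      using lcurry_postcomp[OF g tau_Hom[OF W] X V] rcurry_rot[OF XV W f] by simp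
    then have "mid_assoc C V M W \<cdot> (lact_arr C V (\<tau> W) \<cdot> h) =
        rcurry C W X (V \<triangleright> M) (lcurry C (W \<otimes> X) V M (p \<cdot> \<a> W X V))"
      using mid_assoc_Comp_lcurry[OF X V W M_Obj p] by simp
    then show ?thesis
      using rcurry_postcomp[OF lcurry_Hom[OF WX V M_Obj pa] tau_Hom[OF V] X W]
        rcurry_rot[OF WX V pa] by simp
  qed
  have right: "ract_assoc C M V W \<cdot> (\<tau> (V \<otimes> W) \<cdot> (lact_assoc C V W M \<cdot> h)) =
      rcurry C W X (M \<triangleleft> V) (rcurry C V (W \<otimes> X) M (q \<cdot> inverse_arr C (\<a> V W X)))"
    using lact_assoc_Comp_lcurry[OF X V W M_Obj f] rcurry_rot[OF X VW fi]
      ract_assoc_Comp_rcurry[OF X V W M_Obj q] by (simp add: h_def q_def)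
  note la = lact_arr_Hom[OF V tau_Hom[OF W]] and ra = ract_arr_Hom[OF W tau_Hom[OF V]]
  note ma = mid_assoc_Hom[OF V W M_Obj]
  note as = lact_assoc_Hom[OF V W M_Obj] ract_assoc_Hom[OF V W M_Obj]
  have "ract_arr C (\<tau> V) W \<cdot> (mid_assoc C V M W \<cdot> (lact_arr C V (\<tau> W) \<cdot> h)) =
      ract_arr C (\<tau> V) W \<cdot> mid_assoc C V M W \<cdot> lact_arr C V (\<tau> W) \<cdot> h"
    using Comp_assoc[OF h la Comp_Hom[OF ma ra]] Comp_assoc[OF Comp_Hom[OF h la] ma ra]
    by simp
  also have "\<dots> = ract_assoc C M V W \<cdot> (\<tau> (V \<otimes> W) \<cdot> (lact_assoc C V W M \<cdot> h))"
    using tau_hexagon[OF V W] Comp_assoc[OF h as(1) Comp_Hom[OF tau_Hom[OF VW] as(2)]]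
      Comp_assoc[OF Comp_Hom[OF h as(1)] tau_Hom[OF VW] as(2)] by simp
  finally have eq: "rcurry C W X (M \<triangleleft> V)
        (rcurry C V (W \<otimes> X) M (rot (W \<otimes> X) V (p \<cdot> \<a> W X V))) =
      rcurry C W X (M \<triangleleft> V) (rcurry C V (W \<otimes> X) M (q \<cdot> inverse_arr C (\<a> V W X)))"
    using left right by simp
  note r = rot_Hom[OF WX V pa]
  have "rcurry C V (W \<otimes> X) M (rot (W \<otimes> X) V (p \<cdot> \<a> W X V)) =
      rcurry C V (W \<otimes> X) M (q \<cdot> inverse_arr C (\<a> V W X))"
    using arg_cong[OF eq, of "runcurry C W X (M \<triangleleft> V)"]
      runcurry_rcurry[OF W X ract_Obj[OF V M_Obj]] rcurry_Hom[OF V WX M_Obj r]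
      rcurry_Hom[OF V WX M_Obj qi] by simp
  from arg_cong[OF this, of "runcurry C V (W \<otimes> X) M"] show ?thesis
    using runcurry_rcurry[OF V WX M_Obj r] runcurry_rcurry[OF V WX M_Obj qi]
    by (simp add: p_def q_def)
qed

end


section \<open>Stability makes rotations invertible\<close>

text \<open>An object of the weak center that satisfies the stability condition.\<close>

locale stable_central_object = weak_central_object +
  assumes stable: "stability_map C M \<tau> (Ident C M) = Ident C M"
begin

text \<open>
  Stability gives \<open>rot \<one> M (\<l> M) = \<r> M\<close>. Every arrow \<open>\<one> \<otimes> V \<rightarrow> M\<close> factors through \<open>\<l> M\<close>,
  so naturality determines \<open>rot \<one> V\<close>.
\<close>

lemma rot_unit:
  assumes V: "V \<in> Obj C" and g: "g \<in> Hom C V M"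
  shows "rot \<one> V (g \<cdot> \<l> V) = g \<cdot> \<r> V"
proof -
  note M = M_Obj and I = unit_Obj
  note lM = lunit_Hom[OF M] and rM = runit_Hom[OF M]
  note r = rot_Hom[OF I M lM]
  have "rot \<one> M (\<l> M) \<cdot> inverse_arr C (\<r> M) = Ident C M"
    using stable Ident_Comp[OF lM] by (simp add: stability_map_def rot_def)
  then have rot_l: "rot \<one> M (\<l> M) = \<r> M"
    using inverse_Comp_cancel[OF runit_iso[OF M] rM r] Ident_Comp[OF rM] by simp
  have "rot \<one> V (g \<cdot> \<l> V) = rot \<one> V (\<l> M \<cdot> (Ident C \<one> \<odot> g))"
    using lunit_natural[OF g] by simp
  also have "\<dots> = \<r> M \<cdot> (g \<odot> Ident C \<one>)"
    using rot_natural[OF Ident_Hom[OF I] g lM] rot_l by simp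
  finally show ?thesis
    using runit_natural[OF g] by simp
qed

text \<open>
  The hexagon at \<open>X = \<one>\<close>. The automorphism \<open>k\<close> is a composite of associators and unitors; only
  its invertibility and its independence of \<open>f\<close> matter.
\<close>

lemma rot_rot:
  assumes V: "V \<in> Obj C" and W: "W \<in> Obj C"
  obtains k where "iso C k" "k \<in> Hom C (V \<otimes> W) (V \<otimes> W)"
    "\<And>f. f \<in> Hom C (V \<otimes> W) M \<Longrightarrow> rot W V (rot V W f) = f \<cdot> k"
proof
  note M = M_Obj and I = unit_Obj
  have VW: "V \<otimes> W \<in> Obj C" and IV: "\<one> \<otimes> V \<in> Obj C" and WI: "W \<otimes> \<one> \<in> Obj C"
    using V W I tensor_Obj by simp_all
  note idV = Ident_Hom[OF V] and idW = Ident_Hom[OF W]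
  let ?lV = "\<l> V \<odot> Ident C W" and ?rW = "Ident C V \<odot> \<r> W"
  have lV: "iso C ?lV" "?lV \<in> Hom C (\<one> \<otimes> V \<otimes> W) (V \<otimes> W)"
    using tensor_iso[OF lunit_iso[OF V] lunit_Hom[OF V] Ident_iso[OF W] idW]
      tensor_Hom[OF lunit_Hom[OF V] idW] by simp_all
  have rW: "iso C ?rW" "?rW \<in> Hom C (V \<otimes> (W \<otimes> \<one>)) (V \<otimes> W)"
    using tensor_iso[OF Ident_iso[OF V] idV runit_iso[OF W] runit_Hom[OF W]]
      tensor_Hom[OF idV runit_Hom[OF W]] by simp_all
  note l = lunit_iso[OF VW] lunit_Hom[OF VW] and r = runit_iso[OF VW] runit_Hom[OF VW]
  note a = assoc_iso[OF I V W] assoc_Hom[OF I V W]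
  note a' = assoc_iso[OF V W I] assoc_Hom[OF V W I]
  note il = iso_inverse_arr[OF l] inverse_arr_Hom[OF l]
  note ia = iso_inverse_arr[OF a] inverse_arr_Hom[OF a]
  note ia' = iso_inverse_arr[OF a'] inverse_arr_Hom[OF a']
  note ir = iso_inverse_arr[OF rW] inverse_arr_Hom[OF rW]
  \<comment> \<open>\<open>n\<close> relates the two ways of cancelling the unit in \<open>\<one> \<otimes> V \<otimes> W\<close>, and \<open>n'\<close> those in
    \<open>V \<otimes> W \<otimes> \<one>\<close>.\<close>
  define m where "m = ?lV \<cdot> inverse_arr C (\<a> \<one> V W)"
  have m: "iso C m" "m \<in> Hom C (\<one> \<otimes> (V \<otimes> W)) (V \<otimes> W)"
    unfolding m_def using Comp_iso[OF ia lV] Comp_Hom[OF ia(2) lV(2)] .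
  define m' where "m' = inverse_arr C (\<a> V W \<one>) \<cdot> inverse_arr C ?rW"
  have m': "iso C m'" "m' \<in> Hom C (V \<otimes> W) (V \<otimes> W \<otimes> \<one>)"
    unfolding m'_def using Comp_iso[OF ir ia'] Comp_Hom[OF ir(2) ia'(2)] .
  define n where "n = m \<cdot> inverse_arr C (\<l> (V \<otimes> W))"
  have n: "iso C n" "n \<in> Hom C (V \<otimes> W) (V \<otimes> W)"
    unfolding n_def using Comp_iso[OF il m] Comp_Hom[OF il(2) m(2)] .
  define n' where "n' = \<r> (V \<otimes> W) \<cdot> m'"
  have n': "iso C n'" "n' \<in> Hom C (V \<otimes> W) (V \<otimes> W)"
    unfolding n'_def using Comp_iso[OF m' r] Comp_Hom[OF m'(2) r(2)] .
  show "iso C (n \<cdot> n')" "n \<cdot> n' \<in> Hom C (V \<otimes> W) (V \<otimes> W)"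
    using Comp_iso[OF n' n] Comp_Hom[OF n'(2) n(2)] .
  fix f
  assume f: "f \<in> Hom C (V \<otimes> W) M"
  define g where "g = rot V W f"
  have g: "g \<in> Hom C (W \<otimes> V) M"
    unfolding g_def using rot_Hom[OF V W f] .
  note s = rot_Hom[OF W V g] and fn = Comp_Hom[OF n(2) f]
  note WlV = tensor_Hom[OF idW lunit_Hom[OF V]]
  \<comment> \<open>Insert a unit to the right of \<open>W\<close>, and use the triangle axiom to transfer it to the left of
    \<open>V\<close>, where the hexagon applies to the arrow \<open>f \<cdot> (\<l> V \<odot> Ident C W)\<close>.\<close>
  have "rot W V g \<cdot> ?rW = rot (W \<otimes> \<one>) V (g \<cdot> (\<r> W \<odot> Ident C V))"
    using rot_natural[OF runit_Hom[OF W] idV g] by simp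
  also have "\<dots> = rot (W \<otimes> \<one>) V (g \<cdot> (Ident C W \<odot> \<l> V) \<cdot> \<a> W \<one> V)"
    using triangle[OF W V] Comp_assoc[OF assoc_Hom[OF W I V] WlV g] by simp
  also have "\<dots> = rot (W \<otimes> \<one>) V (rot (\<one> \<otimes> V) W (f \<cdot> ?lV) \<cdot> \<a> W \<one> V)"
    using rot_natural[OF lunit_Hom[OF V] idW f] by (simp add: g_def)
  also have "\<dots> = rot \<one> (V \<otimes> W) (f \<cdot> ?lV \<cdot> inverse_arr C (\<a> \<one> V W)) \<cdot> inverse_arr C (\<a> V W \<one>)"
    using rot_hexagon[OF I V W Comp_Hom[OF lV(2) f]] .
  also have "f \<cdot> ?lV \<cdot> inverse_arr C (\<a> \<one> V W) = f \<cdot> n \<cdot> \<l> (V \<otimes> W)"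
    using Comp_assoc[OF ia(2) lV(2) f] Comp_assoc[OF l(2) n(2) f]
      inverse_Comp_cancel[OF l m(2)] by (simp add: n_def m_def)
  also have "rot \<one> (V \<otimes> W) \<dots> = f \<cdot> n \<cdot> \<r> (V \<otimes> W)"
    using rot_unit[OF VW fn] .
  finally have "rot W V g = f \<cdot> n \<cdot> \<r> (V \<otimes> W) \<cdot> inverse_arr C (\<a> V W \<one>) \<cdot> inverse_arr C ?rW"
    using Comp_inverse_cancel[OF rW s] by simp
  also have "\<dots> = f \<cdot> (n \<cdot> n')"
    using Comp_assoc[OF ir(2) ia'(2) Comp_Hom[OF r(2) fn]] Comp_assoc[OF m'(2) r(2) fn]
      Comp_assoc[OF n'(2) n(2) f] by (simp add: n'_def m'_def)
  finally show "rot W V (rot V W f) = f \<cdot> (n \<cdot> n')"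
    by (simp add: g_def)
qed

lemma rot_rot_bij:
  assumes "V \<in> Obj C" "W \<in> Obj C"
  shows "bij_betw (rot W V \<circ> rot V W) (Hom C (V \<otimes> W) M) (Hom C (V \<otimes> W) M)"
proof -
  obtain k where k: "iso C k" "k \<in> Hom C (V \<otimes> W) (V \<otimes> W)"
    and eq: "\<And>f. f \<in> Hom C (V \<otimes> W) M \<Longrightarrow> rot W V (rot V W f) = f \<cdot> k"
    using rot_rot[OF assms] by blast
  show ?thesis
    using iso_precomp_bij[OF k, of M] eq by (simp cong: bij_betw_cong)
qed

lemma rot_bij:
  assumes V: "V \<in> Obj C" and W: "W \<in> Obj C"
  shows "bij_betw (rot V W) (Hom C (V \<otimes> W) M) (Hom C (W \<otimes> V) M)"
proof (rule bij_betw_imageI)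
  show "inj_on (rot V W) (Hom C (V \<otimes> W) M)"
    using bij_betw_imp_inj_on[OF rot_rot_bij[OF V W]] by (rule inj_on_imageI2)
  have "Hom C (W \<otimes> V) M = rot V W ` rot W V ` Hom C (W \<otimes> V) M"
    using bij_betw_imp_surj_on[OF rot_rot_bij[OF W V]] by (simp add: image_comp)
  then show "rot V W ` Hom C (V \<otimes> W) M = Hom C (W \<otimes> V) M"
    using rot_Hom[OF V W] rot_Hom[OF W V] by blast
qed

lemma tau_iso:
  assumes V: "V \<in> Obj C"
  shows "iso C (\<tau> V)"
proof (rule iso_if_postcomp_bij[OF tau_Hom[OF V]])
  fix X
  assume X: "X \<in> Obj C"
  \<comment> \<open>Composition with \<open>\<tau> V\<close> is \<open>rot X V\<close> conjugated by the adjunction bijections.\<close>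
  let ?h = "rcurry C V X M \<circ> (rot X V \<circ> luncurry C X V M)"
  have "bij_betw ?h (Hom C X (V \<triangleright> M)) (Hom C X (M \<triangleleft> V))"
    using bij_betw_trans[OF bij_betw_trans[OF luncurry_bij[OF X V M_Obj] rot_bij[OF X V]]
        rcurry_bij[OF V X M_Obj]] by (simp add: ract_def)
  moreover have "?h g = \<tau> V \<cdot> g" if g: "g \<in> Hom C X (V \<triangleright> M)" for g
    using rcurry_rot[OF X V luncurry_Hom[OF X V M_Obj g]] lcurry_luncurry[OF X V M_Obj g]
    by simp
  ultimately show "bij_betw (\<lambda>g. \<tau> V \<cdot> g) (Hom C X (V \<triangleright> M)) (Hom C X (M \<triangleleft> V))"
    by (subst bij_betw_cong[where g = ?h]) simp_all
qed

end

theorem lemma2p4: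
  fixes C :: "('o, 'a, 'm) biclosed_data_scheme"
    and M :: 'o and \<tau> :: "'o \<Rightarrow> 'a"
  assumes "biclosed_monoidal_category C"
    and "(M, \<tau>) \<in> stable_weak_center C"
  shows "(M, \<tau>) \<in> center C"
proof -
  have weak: "(M, \<tau>) \<in> weak_center C"
    and stable: "stability_map C M \<tau> (Ident C M) = Ident C M"
    using assms(2) by (simp_all add: stable_weak_center_def)
  interpret biclosed_monoidal_category C
    by (rule assms(1))
  interpret stable_central_object C M \<tau>
    using weak stable by unfold_locales
  show ?thesis
    using weak tau_iso by (simp add: center_def)
qed

end
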